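(* Let $x=(x_1,\dots,x_n)\in\mathbb{R}^n$ and $\lambda=(\lambda_1,\dots,\lambda_n)\in\mathbb{R}^n$, let $N=\{1,\dots,n\}$, and let $\rho$ be a given loss function. Then the nested measure $\mathfrak{b}(x,\rho)$ is computed as the optimal value, denoted $\mathfrak{b}_1(x,\rho)$, of the following single-level optimization problem in the variables $\theta$ and $t_k,v_{ik},d_{ik}$ ($i,k\in N$): $$ \begin{aligned} \mathfrak{b}_1(x,\rho)=\min\ & \rho(x,\theta)\\ \text{s.t. } & \theta=\sum_{k\in\Delta^+}|\Delta_k|\Big((n-k+1)t_k+\sum_{i=1}^n v_{ik}\Big)-\sum_{k\in\Delta^-}|\Delta_k|\sum_{i=1}^n d_{ik}x_i,\\ & \theta=-\sum_{k\in\Delta^-}|\Delta_k|\Big((n-k+1)t_k+\sum_{i=1}^n v_{ik}\Big)+\sum_{k\in\Delta^+}|\Delta_k|\sum_{i=1}^n d_{ik}x_i,\\ & t_k+v_{ik}\ge x_i, && \forall i,k\in N,\\ & \sum_{i=1}^n d_{ik}=n-k+1, && \forall k\in N,\\ & t_k\in\mathbb{R},\ v_{ik}\ge 0, && \forall i,k\in N,\\ & 0\le d_{ik}\le 1, && \forall i,k\in N,\\ & \theta\ge 0. \end{aligned} $$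
   Context: For $x\in\mathbb{R}^n$, $x_{(1)}\le x_{(2)}\le\dots\le x_{(n)}$ denote the components of $x$ sorted in nondecreasing order (with multiplicity). For $\lambda\in\mathbb{R}^n$ put $\lambda_0:=0$ and $\Delta_k:=\lambda_k-\lambda_{k-1}$ for $k\in\{1,\dots,n\}$, and let $\Delta^+=\{k\in\{1,\dots,n\}:\Delta_k>0\}$ and $\Delta^-=\{k\in\{1,\dots,n\}:\Delta_k<0\}$. The vectors $x$ and $\lambda$ are given data, not decision variables. The loss function $\rho$ takes a vector in $\mathbb{R}^n$ and a scalar as arguments and returns a real value. The nested measure is $\mathfrak{b}(x,\rho):=\min\rho\big(x,\sum_{k=1}^n\lambda_kx_{(k)}\big)$, that is, the minimum of $\rho(x,\theta)$ subject to $\theta=\ell(x,\lambda)$, where $\ell(x,\lambda)=\sum_{k=1}^n\lambda_kx_{(k)}$; in the formulation the value $\ell(x,\lambda)$ is represented by the nonnegative variable $\theta$.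
   Formalization: The formal statement assumes that the value ℓ(x,λ)=∑λ_k x_(k) is nonnegative; otherwise the constraint θ≥0 makes the single-level problem infeasible (e.g. n=1, x=1, λ=−1) while the nested measure is still ρ(x,ℓ(x,λ)). *)

theory Defs
  imports Complex_Main "HOL-Library.Extended_Real"
begin

text \<open>
  A vector of \<open>\<real>\<^sup>n\<close> is a function \<open>nat \<Rightarrow> real\<close> of which only the values at the
  indices \<open>1, \<dots>, n\<close> are relevant; matrices \<open>(v\<^sub>i\<^sub>k)\<close> are curried in the same way.
\<close>

definition order_stat :: "nat \<Rightarrow> (nat \<Rightarrow> real) \<Rightarrow> nat \<Rightarrow> real" where
  "order_stat n x k = sort (map x [1..<Suc n]) ! (k - 1)"

definition ordered_weighted_sum :: "nat \<Rightarrow> (nat \<Rightarrow> real) \<Rightarrow> (nat \<Rightarrow> real) \<Rightarrow> real" where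
  "ordered_weighted_sum n x lam = (\<Sum>k = 1..n. lam k * order_stat n x k)"

text \<open>The convention \<open>\<lambda>\<^sub>0 = 0\<close> is built in, so the value \<open>lam 0\<close> is never used.\<close>

definition Delta :: "(nat \<Rightarrow> real) \<Rightarrow> nat \<Rightarrow> real" where
  "Delta lam k = lam k - (if k = 1 then 0 else lam (k - 1))"

definition Delta_pos :: "nat \<Rightarrow> (nat \<Rightarrow> real) \<Rightarrow> nat set" where
  "Delta_pos n lam = {k \<in> {1..n}. Delta lam k > 0}"

definition Delta_neg :: "nat \<Rightarrow> (nat \<Rightarrow> real) \<Rightarrow> nat set" where
  "Delta_neg n lam = {k \<in> {1..n}. Delta lam k < 0}"

text \<open>
  The optimal value of a minimization problem, equal to \<open>\<infinity>\<close> if the problem is infeasible.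
  That the infimum is a minimum is the existence of an \<^const>\<open>is_arg_min\<close>.
\<close>

definition opt_value :: "('a \<Rightarrow> real) \<Rightarrow> 'a set \<Rightarrow> ereal" where
  "opt_value f S = (INF s\<in>S. ereal (f s))"

definition nested_measure ::
  "nat \<Rightarrow> (nat \<Rightarrow> real) \<Rightarrow> (nat \<Rightarrow> real) \<Rightarrow> ((nat \<Rightarrow> real) \<Rightarrow> real \<Rightarrow> real) \<Rightarrow> ereal" where
  "nested_measure n x lam rho =
     opt_value (\<lambda>\<theta>. rho x \<theta>) {\<theta>. \<theta> = ordered_weighted_sum n x lam}"

type_synonym decision =
  "real \<times> (nat \<Rightarrow> real) \<times> (nat \<Rightarrow> nat \<Rightarrow> real) \<times> (nat \<Rightarrow> nat \<Rightarrow> real)"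

definition feasible :: "nat \<Rightarrow> (nat \<Rightarrow> real) \<Rightarrow> (nat \<Rightarrow> real) \<Rightarrow> decision set" where
  "feasible n x lam = {(\<theta>, t, v, d).
     \<theta> = (\<Sum>k\<in>Delta_pos n lam.
            \<bar>Delta lam k\<bar> * ((real n - real k + 1) * t k + (\<Sum>i = 1..n. v i k)))
         - (\<Sum>k\<in>Delta_neg n lam. \<bar>Delta lam k\<bar> * (\<Sum>i = 1..n. d i k * x i)) \<and>
     \<theta> = - (\<Sum>k\<in>Delta_neg n lam.
            \<bar>Delta lam k\<bar> * ((real n - real k + 1) * t k + (\<Sum>i = 1..n. v i k)))
         + (\<Sum>k\<in>Delta_pos n lam. \<bar>Delta lam k\<bar> * (\<Sum>i = 1..n. d i k * x i)) \<and>
     (\<forall>i\<in>{1..n}. \<forall>k\<in>{1..n}. t k + v i k \<ge> x i) \<and>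
     (\<forall>k\<in>{1..n}. (\<Sum>i = 1..n. d i k) = real n - real k + 1) \<and>
     (\<forall>i\<in>{1..n}. \<forall>k\<in>{1..n}. v i k \<ge> 0) \<and>
     (\<forall>i\<in>{1..n}. \<forall>k\<in>{1..n}. 0 \<le> d i k \<and> d i k \<le> 1) \<and>
     \<theta> \<ge> 0}"

definition objective ::
  "(nat \<Rightarrow> real) \<Rightarrow> ((nat \<Rightarrow> real) \<Rightarrow> real \<Rightarrow> real) \<Rightarrow> decision \<Rightarrow> real" where
  "objective x rho = (\<lambda>(\<theta>, t, v, d). rho x \<theta>)"

definition single_level_value ::
  "nat \<Rightarrow> (nat \<Rightarrow> real) \<Rightarrow> (nat \<Rightarrow> real) \<Rightarrow> ((nat \<Rightarrow> real) \<Rightarrow> real \<Rightarrow> real) \<Rightarrow> ereal" where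
  "single_level_value n x lam rho = opt_value (objective x rho) (feasible n x lam)"

end

theory Submission imports Defs "HOL-Library.Multiset" begin

text \<open>
  Let \<open>T\<^sub>k = x\<^sub>(\<^sub>k\<^sub>) + \<dots> + x\<^sub>(\<^sub>n\<^sub>)\<close> be the sum of the \<open>n - k + 1\<close> largest entries of \<open>x\<close>.
  Summation by parts gives \<open>\<ell>(x, \<lambda>) = \<Sum>\<^sub>k \<Delta>\<^sub>k T\<^sub>k\<close> (\<open>sum_Delta_top_sum\<close>), so it is enough to control
  the \<open>T\<^sub>k\<close>. Each of them is the common optimal value of a pair of dual linear programs:
  maximize \<open>\<Sum>\<^sub>i d\<^sub>i x\<^sub>i\<close> over \<open>0 \<le> d\<^sub>i \<le> 1\<close> with \<open>\<Sum>\<^sub>i d\<^sub>i = n - k + 1\<close>, and minimize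
  \<open>(n - k + 1) t + \<Sum>\<^sub>i v\<^sub>i\<close> over \<open>v\<^sub>i \<ge> 0\<close> with \<open>t + v\<^sub>i \<ge> x\<^sub>i\<close>. Weak duality is
  \<open>selection_le_cover\<close>; the value \<open>T\<^sub>k\<close> is attained by selecting the largest entries
  (\<open>top_sum_selection\<close>) and by taking the threshold \<open>t = x\<^sub>(\<^sub>k\<^sub>)\<close> (\<open>top_sum_cover\<close>). Playing each
  attaining solution against an arbitrary solution of the other program shows that at every feasible
  point the selection values are at most \<open>T\<^sub>k\<close> and the cover values at least \<open>T\<^sub>k\<close>.

  The signs in the two equations for \<open>\<theta>\<close> are arranged so that the first one uses an upper bound of
  \<open>\<Delta>\<^sub>k T\<^sub>k\<close> for every \<open>k\<close>, and the second one a lower bound. Hence \<open>\<theta> \<ge> \<ell>(x, \<lambda>)\<close> and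
  \<open>\<theta> \<le> \<ell>(x, \<lambda>)\<close>: the only feasible value of \<open>\<theta>\<close> is \<open>\<ell>(x, \<lambda>)\<close>. The attaining solutions do
  satisfy both equations with this value, and it is admissible because it is nonnegative. The
  objective is therefore constant on a nonempty feasible set, with the value that defines the nested
  measure.
\<close>

section \<open>Order statistics\<close>

lemma order_stat_mono:
  assumes "1 \<le> j" "j \<le> k" "k \<le> n"
  shows "order_stat n x j \<le> order_stat n x k"
  unfolding order_stat_def using assms by (intro sorted_nth_mono) auto

text \<open>
  Sorting the indices by their values, rather than the values themselves, gives the permutation.
\<close>

lemma order_stat_permutation:
  obtains p where "bij_betw p {1..n} {1..n}" "\<And>k. k \<in> {1..n} \<Longrightarrow> order_stat n x k = x (p k)"
proof -
  define L where "L = sort_key x [1..<Suc n]"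
  have len: "length L = n" and dist: "distinct L" and set: "set L = {1..n}"
    unfolding L_def by auto
  have sort: "sort (map x [1..<Suc n]) = map x L"
    unfolding L_def by (rule properties_for_sort) (simp_all del: upt_Suc)
  have "bij_betw (\<lambda>k. k - 1) {1..n} {..<n}"
    by (rule bij_betw_byWitness[where f' = Suc]) auto
  moreover have "bij_betw ((!) L) {..<n} {1..n}"
    using bij_betw_nth[OF dist] len set by auto
  ultimately have "bij_betw (\<lambda>k. L ! (k - 1)) {1..n} {1..n}"
    using bij_betw_trans by (fastforce simp: o_def)
  moreover have "order_stat n x k = x (L ! (k - 1))" if "k \<in> {1..n}" for k
    unfolding order_stat_def sort using that len by (intro nth_map) auto
  ultimately show thesis by (rule that)
qed

section \<open>Sums of largest entries by linear programming duality\<close>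

definition top_sum :: "nat \<Rightarrow> (nat \<Rightarrow> real) \<Rightarrow> nat \<Rightarrow> real" where
  "top_sum n x k = (\<Sum>j = k..n. order_stat n x j)"

text \<open>
  Multiplying \<open>x\<^sub>i \<le> t + v\<^sub>i\<close> by \<open>d\<^sub>i \<ge> 0\<close> and using \<open>d\<^sub>i v\<^sub>i \<le> v\<^sub>i\<close>: weak duality.
\<close>

lemma selection_le_cover:
  fixes x v d :: "'a \<Rightarrow> real"
  assumes "\<And>i. i \<in> A \<Longrightarrow> x i \<le> t + v i" "\<And>i. i \<in> A \<Longrightarrow> 0 \<le> v i"
    and "\<And>i. i \<in> A \<Longrightarrow> 0 \<le> d i" "\<And>i. i \<in> A \<Longrightarrow> d i \<le> 1"
  shows "(\<Sum>i\<in>A. d i * x i) \<le> (\<Sum>i\<in>A. d i) * t + (\<Sum>i\<in>A. v i)"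
proof -
  have "(\<Sum>i\<in>A. d i * x i) \<le> (\<Sum>i\<in>A. d i * t + v i)"
  proof (rule sum_mono)
    fix i assume i: "i \<in> A"
    have "d i * x i \<le> d i * (t + v i)"
      using assms(1,3)[OF i] by (rule mult_left_mono)
    also have "\<dots> \<le> d i * t + v i"
      using mult_right_mono[OF assms(4)[OF i] assms(2)[OF i]] by (simp add: distrib_left)
    finally show "d i * x i \<le> d i * t + v i" .
  qed
  then show ?thesis by (simp add: sum.distrib sum_distrib_right)
qed

lemma top_sum_selection:
  assumes k: "k \<in> {1..n}"
  obtains d :: "nat \<Rightarrow> real" where "\<And>i. 0 \<le> d i \<and> d i \<le> 1"
    "(\<Sum>i = 1..n. d i) = real n - real k + 1" "(\<Sum>i = 1..n. d i * x i) = top_sum n x k"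
proof -
  obtain p where p: "bij_betw p {1..n} {1..n}"
    "\<And>k. k \<in> {1..n} \<Longrightarrow> order_stat n x k = x (p k)"
    using order_stat_permutation[of n x] by metis
  have inj: "inj_on p {k..n}"
    using p(1) k by (auto simp: bij_betw_def intro: inj_on_subset)
  have sub: "p ` {k..n} \<subseteq> {1..n}"
    using p(1) k by (force simp: bij_betw_def)
  define d :: "nat \<Rightarrow> real" where "d i = of_bool (i \<in> p ` {k..n})" for i
  have sel: "(\<Sum>i = 1..n. d i * f i) = (\<Sum>j = k..n. f (p j))" for f :: "nat \<Rightarrow> real"
  proof -
    have "(\<Sum>i = 1..n. d i * f i) = (\<Sum>i\<in>p ` {k..n}. f i)"
      using sub by (intro sum.mono_neutral_cong_right) (auto simp: d_def)
    also have "\<dots> = (\<Sum>j = k..n. f (p j))"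
      using inj by (simp add: sum.reindex)
    finally show ?thesis .
  qed
  show thesis
  proof (rule that[of d])
    show "0 \<le> d i \<and> d i \<le> 1" for i
      by (simp add: d_def)
    show "(\<Sum>i = 1..n. d i) = real n - real k + 1"
      using sel[of "\<lambda>_. 1"] k by (simp add: of_nat_diff)
    show "(\<Sum>i = 1..n. d i * x i) = top_sum n x k"
      unfolding sel top_sum_def using k p(2) by (intro sum.cong) auto
  qed
qed

text \<open>
  With the threshold \<open>x\<^sub>(\<^sub>k\<^sub>)\<close>, the excess over it vanishes below rank \<open>k\<close> and is
  \<open>x\<^sub>(\<^sub>j\<^sub>) - x\<^sub>(\<^sub>k\<^sub>)\<close> at every rank \<open>j \<ge> k\<close>.
\<close>

lemma top_sum_cover:
  assumes k: "k \<in> {1..n}"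
  shows "(real n - real k + 1) * order_stat n x k
    + (\<Sum>i = 1..n. max 0 (x i - order_stat n x k)) = top_sum n x k"
proof -
  obtain p where p: "bij_betw p {1..n} {1..n}"
    "\<And>k. k \<in> {1..n} \<Longrightarrow> order_stat n x k = x (p k)"
    using order_stat_permutation[of n x] by metis
  let ?t = "order_stat n x k"
  have "(\<Sum>i = 1..n. max 0 (x i - ?t)) = (\<Sum>j = 1..n. max 0 (x (p j) - ?t))"
    using sum.reindex_bij_betw[OF p(1), of "\<lambda>i. max 0 (x i - ?t)"] by simp
  also have "\<dots> = (\<Sum>j = 1..n. max 0 (order_stat n x j - ?t))"
    using p(2) by simp
  also have "\<dots> = (\<Sum>j = k..n. order_stat n x j - ?t)"
    using k order_stat_mono[of _ k n x] order_stat_mono[of k _ n x]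
    by (intro sum.mono_neutral_cong_right) (auto simp: max_def antisym)
  also have "\<dots> = top_sum n x k - (real n - real k + 1) * ?t"
    using k by (simp add: top_sum_def sum_subtractf of_nat_diff)
  finally show ?thesis by simp
qed

section \<open>Summation by parts\<close>

lemma sum_Delta:
  assumes "1 \<le> n"
  shows "(\<Sum>k = 1..n. Delta lam k) = lam n"
  using assms by (induction n rule: dec_induct) (auto simp: Delta_def)

lemma summation_by_parts_Delta:
  "(\<Sum>k = 1..n. Delta lam k * (\<Sum>j = k..n. y j)) = (\<Sum>k = 1..n. lam k * y k)"
proof (induction n)
  case 0
  show ?case by simp
next
  case (Suc n)
  have "(\<Sum>k = 1..Suc n. Delta lam k * (\<Sum>j = k..Suc n. y j))
    = (\<Sum>k = 1..n. Delta lam k * (\<Sum>j = k..n. y j)) + (\<Sum>k = 1..Suc n. Delta lam k) * y (Suc n)"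
    by (simp add: sum.distrib distrib_left distrib_right sum_distrib_right)
  also have "\<dots> = (\<Sum>k = 1..n. lam k * y k) + lam (Suc n) * y (Suc n)"
    by (simp only: Suc.IH sum_Delta)
  finally show ?case by simp
qed

lemma sum_Delta_top_sum:
  "(\<Sum>k = 1..n. Delta lam k * top_sum n x k) = ordered_weighted_sum n x lam"
  unfolding top_sum_def ordered_weighted_sum_def by (rule summation_by_parts_Delta)

lemma ordered_weighted_sum_signed:
  "ordered_weighted_sum n x lam = (\<Sum>k\<in>Delta_pos n lam. \<bar>Delta lam k\<bar> * top_sum n x k)
    - (\<Sum>k\<in>Delta_neg n lam. \<bar>Delta lam k\<bar> * top_sum n x k)"
proof -
  have "(\<Sum>k\<in>Delta_pos n lam. \<bar>Delta lam k\<bar> * top_sum n x k)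
      - (\<Sum>k\<in>Delta_neg n lam. \<bar>Delta lam k\<bar> * top_sum n x k)
    = (\<Sum>k\<in>Delta_pos n lam. Delta lam k * top_sum n x k)
      + (\<Sum>k\<in>Delta_neg n lam. Delta lam k * top_sum n x k)"
    by (simp add: Delta_pos_def Delta_neg_def flip: sum_negf)
  also have "\<dots> = (\<Sum>k\<in>Delta_pos n lam \<union> Delta_neg n lam. Delta lam k * top_sum n x k)"
    by (rule sum.union_disjoint[symmetric]) (auto simp: Delta_pos_def Delta_neg_def)
  also have "\<dots> = (\<Sum>k = 1..n. Delta lam k * top_sum n x k)"
    by (rule sum.mono_neutral_left) (auto simp: Delta_pos_def Delta_neg_def)
  finally show ?thesis by (simp only: sum_Delta_top_sum)
qed

section \<open>The feasible set\<close>

text \<open>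
  In the first equation \<open>\<Delta>\<^sub>k > 0\<close> meets a cover value and \<open>\<Delta>\<^sub>k < 0\<close> a selection value, so every summand
  is at least \<open>\<Delta>\<^sub>k T\<^sub>k\<close>; the second equation exchanges the roles and reverses the bound.
\<close>

lemma feasible_value_unique:
  assumes "(\<theta>, t, v, d) \<in> feasible n x lam"
  shows "\<theta> = ordered_weighted_sum n x lam"
proof -
  let ?P = "\<lambda>k. (real n - real k + 1) * t k + (\<Sum>i = 1..n. v i k)"
  let ?D = "\<lambda>k. \<Sum>i = 1..n. d i k * x i"
  have first: "\<theta> = (\<Sum>k\<in>Delta_pos n lam. \<bar>Delta lam k\<bar> * ?P k)
      - (\<Sum>k\<in>Delta_neg n lam. \<bar>Delta lam k\<bar> * ?D k)"
    and second: "\<theta> = - (\<Sum>k\<in>Delta_neg n lam. \<bar>Delta lam k\<bar> * ?P k)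
      + (\<Sum>k\<in>Delta_pos n lam. \<bar>Delta lam k\<bar> * ?D k)"
    and cover: "\<And>i k. i \<in> {1..n} \<Longrightarrow> k \<in> {1..n} \<Longrightarrow> x i \<le> t k + v i k \<and> 0 \<le> v i k"
    and total: "\<And>k. k \<in> {1..n} \<Longrightarrow> (\<Sum>i = 1..n. d i k) = real n - real k + 1"
    and select: "\<And>i k. i \<in> {1..n} \<Longrightarrow> k \<in> {1..n} \<Longrightarrow> 0 \<le> d i k \<and> d i k \<le> 1"
    using assms unfolding feasible_def by auto
  have P: "top_sum n x k \<le> ?P k" if k: "k \<in> {1..n}" for k
  proof -
    obtain e :: "nat \<Rightarrow> real" where e: "\<And>i. 0 \<le> e i \<and> e i \<le> 1"
      "(\<Sum>i = 1..n. e i) = real n - real k + 1" "(\<Sum>i = 1..n. e i * x i) = top_sum n x k"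
      using top_sum_selection[OF k] by metis
    show ?thesis
      using selection_le_cover[of "{1..n}" x "t k" "\<lambda>i. v i k" e] cover[OF _ k] e by auto
  qed
  have D: "?D k \<le> top_sum n x k" if k: "k \<in> {1..n}" for k
  proof -
    let ?t = "order_stat n x k"
    have "?D k \<le> (\<Sum>i = 1..n. d i k) * ?t + (\<Sum>i = 1..n. max 0 (x i - ?t))"
      using select[OF _ k] by (intro selection_le_cover) auto
    then show ?thesis by (simp only: total[OF k] top_sum_cover[OF k])
  qed
  have weighted_P: "(\<Sum>k\<in>K. \<bar>Delta lam k\<bar> * top_sum n x k) \<le> (\<Sum>k\<in>K. \<bar>Delta lam k\<bar> * ?P k)"
    if "K \<subseteq> {1..n}" for K
    using that by (intro sum_mono mult_left_mono P) auto
  have weighted_D: "(\<Sum>k\<in>K. \<bar>Delta lam k\<bar> * ?D k) \<le> (\<Sum>k\<in>K. \<bar>Delta lam k\<bar> * top_sum n x k)"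
    if "K \<subseteq> {1..n}" for K
    using that by (intro sum_mono mult_left_mono D) auto
  have sub: "Delta_pos n lam \<subseteq> {1..n}" "Delta_neg n lam \<subseteq> {1..n}"
    by (auto simp: Delta_pos_def Delta_neg_def)
  show ?thesis
  proof (rule antisym)
    show "\<theta> \<le> ordered_weighted_sum n x lam"
      using weighted_P[OF sub(2)] weighted_D[OF sub(1)]
      unfolding ordered_weighted_sum_signed second by linarith
    show "ordered_weighted_sum n x lam \<le> \<theta>"
      using weighted_P[OF sub(1)] weighted_D[OF sub(2)]
      unfolding ordered_weighted_sum_signed first by linarith
  qed
qed

lemma feasible_nonempty:
  assumes "0 \<le> ordered_weighted_sum n x lam"
  shows "feasible n x lam \<noteq> {}"
proof -
  have "\<exists>d :: nat \<Rightarrow> real. (\<forall>i. 0 \<le> d i \<and> d i \<le> 1) \<and>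
    (\<Sum>i = 1..n. d i) = real n - real k + 1 \<and> (\<Sum>i = 1..n. d i * x i) = top_sum n x k"
    if "k \<in> {1..n}" for k
    using top_sum_selection[OF that] by metis
  then obtain d :: "nat \<Rightarrow> nat \<Rightarrow> real" where d: "\<And>k i. k \<in> {1..n} \<Longrightarrow> 0 \<le> d k i \<and> d k i \<le> 1"
    "\<And>k. k \<in> {1..n} \<Longrightarrow> (\<Sum>i = 1..n. d k i) = real n - real k + 1"
    "\<And>k. k \<in> {1..n} \<Longrightarrow> (\<Sum>i = 1..n. d k i * x i) = top_sum n x k"
    by metis
  let ?t = "order_stat n x" and ?v = "\<lambda>i k. max 0 (x i - order_stat n x k)"
  have cover: "(\<Sum>k\<in>K. \<bar>Delta lam k\<bar> * ((real n - real k + 1) * ?t k + (\<Sum>i = 1..n. ?v i k)))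
      = (\<Sum>k\<in>K. \<bar>Delta lam k\<bar> * top_sum n x k)" if "K \<subseteq> {1..n}" for K
    using that top_sum_cover[of _ n x] by (intro sum.cong) auto
  have select: "(\<Sum>k\<in>K. \<bar>Delta lam k\<bar> * (\<Sum>i = 1..n. d k i * x i))
      = (\<Sum>k\<in>K. \<bar>Delta lam k\<bar> * top_sum n x k)" if "K \<subseteq> {1..n}" for K
    using that d(3) by (intro sum.cong) auto
  have sub: "Delta_pos n lam \<subseteq> {1..n}" "Delta_neg n lam \<subseteq> {1..n}"
    by (auto simp: Delta_pos_def Delta_neg_def)
  have "(ordered_weighted_sum n x lam, ?t, ?v, \<lambda>i k. d k i) \<in> feasible n x lam"
    unfolding feasible_def mem_Collect_eq prod.case cover[OF sub(1)] cover[OF sub(2)]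
      select[OF sub(1)] select[OF sub(2)]
    using assms d(1,2) ordered_weighted_sum_signed[of n x lam] by auto
  then show ?thesis by blast
qed

theorem theorem2:
  fixes n :: nat
    and x lam :: "nat \<Rightarrow> real"
    and rho :: "(nat \<Rightarrow> real) \<Rightarrow> real \<Rightarrow> real"
  assumes "ordered_weighted_sum n x lam \<ge> 0"
  shows "(\<exists>p. is_arg_min (objective x rho) (\<lambda>q. q \<in> feasible n x lam) p) \<and>
         single_level_value n x lam rho = nested_measure n x lam rho"
proof -
  have const: "objective x rho q = rho x (ordered_weighted_sum n x lam)"
    if "q \<in> feasible n x lam" for q
    using that feasible_value_unique by (cases q) (auto simp: objective_def)
  obtain p where p: "p \<in> feasible n x lam"
    using feasible_nonempty[OF assms] by blast
  have "is_arg_min (objective x rho) (\<lambda>q. q \<in> feasible n x lam) p"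
    using p const by (auto simp: is_arg_min_def)
  moreover have "single_level_value n x lam rho = nested_measure n x lam rho"
  proof -
    have "(\<lambda>q. ereal (objective x rho q)) ` feasible n x lam
      = {ereal (rho x (ordered_weighted_sum n x lam))}"
      using p const by (auto simp: image_iff intro!: bexI[of _ p])
    then show ?thesis
      by (simp add: single_level_value_def nested_measure_def opt_value_def)
  qed
  ultimately show ?thesis by blast
qed

end
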